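(* Let $\mathbf m=(m_1,\ldots,m_p)\in\mathbb N^p$, $n\in\mathbb N$ and $|x|<1$. Then \[ 2n\int_0^x t^{2n-1}dt\,\frac{dt}{1-t^2}\Big(\frac{dt}{t}\Big)^{m_1-1}\frac{t\,dt}{1-t^2}\Big(\frac{dt}{t}\Big)^{m_2-1}\cdots\frac{t\,dt}{1-t^2}\Big(\frac{dt}{t}\Big)^{m_p-1} =(2n-1)\int_0^x t^{2n-2}dt\,\frac{t\,dt}{1-t^2}\Big(\frac{dt}{t}\Big)^{m_1-1}\frac{t\,dt}{1-t^2}\Big(\frac{dt}{t}\Big)^{m_2-1}\cdots\frac{t\,dt}{1-t^2}\Big(\frac{dt}{t}\Big)^{m_p-1} \] \[ =\sum_{j=1}^p(-1)^{j-1}t^\star_n(m_1,\ldots,m_{j-1})\,\mathrm{ti}_{m_p,\ldots,m_j}(x)+(-1)^p t^\star_n(\mathbf m;x). \]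
   Context: Iterated integrals: $\int_a^b f_q(t)dt\cdots f_1(t)dt:=\int_{a<t_q<\cdots<t_1<b}f_q(t_q)\cdots f_1(t_1)\,dt_1\cdots dt_q$, along the straight segment. For a composition $\mathbf k=(k_1,\ldots,k_r)$: $t^\star_n(\mathbf k)=\sum_{n\ge n_1\ge\cdots\ge n_r\ge1}\prod_i(2n_i-1)^{-k_i}$ (with $t^\star_n(\emptyset)=1$), $t^\star_n(\mathbf k;x)=\sum_{n\ge n_1\ge\cdots\ge n_r\ge1}x^{2n_r-1}\prod_i(2n_i-1)^{-k_i}$, and the multiple $t$-polylogarithm $\mathrm{ti}_{\mathbf k}(x)=\sum_{n_1>\cdots>n_r>0}x^{2n_1-1}\prod_i(2n_i-1)^{-k_i}$. *)

theory Defs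
  imports "HOL-Analysis.Analysis"
begin

definition osimplex :: "nat \<Rightarrow> (nat \<Rightarrow> real) set" where
  "osimplex q = {s. (\<forall>i<q. 0 < s i \<and> s i < 1) \<and> (\<forall>i j. i < j \<and> j < q \<longrightarrow> s i < s j)}"

text \<open>Iterated integral along the straight segment from a to b.
  The list fs = [g_0, ..., g_(q-1)] is the integrand written left to right,
  i.e. iint a b fs = int_a^b g_0(t)dt ... g_(q-1)(t)dt
  = int_(a < t_0 < ... < t_(q-1) < b) g_0(t_0) ... g_(q-1)(t_(q-1)),
  with the ordering taken along the segment t = a + s (b - a), 0 < s < 1.\<close>
definition iint :: "complex \<Rightarrow> complex \<Rightarrow> (complex \<Rightarrow> complex) list \<Rightarrow> complex" where
  "iint a b fs = (b - a) ^ length fs *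
     (LINT s : osimplex (length fs) | PiM {..<length fs} (\<lambda>_. lborel).
        (\<Prod>i<length fs. (fs ! i) (a + of_real (s i) * (b - a))))"

definition blk :: "nat \<Rightarrow> (complex \<Rightarrow> complex) \<Rightarrow> (complex \<Rightarrow> complex) list" where
  "blk k f = f # replicate (k - 1) (\<lambda>t. 1 / t)"

definition idx_le :: "nat \<Rightarrow> nat \<Rightarrow> nat list set" where
  "idx_le n r = {ns. length ns = r \<and> (\<forall>i<r. 1 \<le> ns ! i \<and> ns ! i \<le> n) \<and> sorted_wrt (\<ge>) ns}"

definition tstar :: "nat \<Rightarrow> nat list \<Rightarrow> complex" where
  "tstar n ks = (\<Sum>ns\<in>idx_le n (length ks).
      \<Prod>i<length ks. 1 / (of_nat (2 * ns ! i - 1)) ^ (ks ! i))"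

text \<open>t*_n(k; x); the factor x^(2 n_r - 1) uses the last index n_r (only used for r >= 1).\<close>
definition tstarx :: "nat \<Rightarrow> nat list \<Rightarrow> complex \<Rightarrow> complex" where
  "tstarx n ks x = (\<Sum>ns\<in>idx_le n (length ks).
      x ^ (2 * last ns - 1) * (\<Prod>i<length ks. 1 / (of_nat (2 * ns ! i - 1)) ^ (ks ! i)))"

definition idx_gt :: "nat \<Rightarrow> nat list set" where
  "idx_gt r = {ns. length ns = r \<and> (\<forall>i<r. 0 < ns ! i) \<and> sorted_wrt (>) ns}"

definition ti :: "nat list \<Rightarrow> complex \<Rightarrow> complex" where
  "ti ks x = (\<Sum>\<^sub>\<infinity>ns\<in>idx_gt (length ks).
      x ^ (2 * hd ns - 1) * (\<Prod>i<length ks. 1 / (of_nat (2 * ns ! i - 1)) ^ (ks ! i)))"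

end

theory Submission
  imports Defs
begin

text \<open>
  Integrating from the innermost form outwards, every partial iterated integral is an odd power
  series \<open>\<Sum>\<^sub>k c\<^sub>k z\<^bsup>2k+1\<^esup>\<close> on the unit disc. A form \<open>dt/t\<close> divides \<open>c\<^sub>k\<close> by \<open>2k+1\<close>, and a form
  \<open>t dt/(1-t\<^sup>2)\<close> replaces \<open>c\<^sub>k\<close> by \<open>(c\<^sub>0 + \<dots> + c\<^bsub>k-1\<^esub>)/(2k+1)\<close>. After the first two forms both integrals
  have the same series, so both equal
  \<open>S\<^sub>n(m\<^sub>1,\<dots>,m\<^sub>p) = \<Sum> x\<^bsup>2l\<^sub>p-1\<^esup> / \<Prod>\<^sub>i (2l\<^sub>i-1)\<^bsup>m\<^sub>i\<^esup>\<close>, summed over \<open>l\<^sub>p > \<dots> > l\<^sub>1 > n\<close>.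
  Writing the sum over \<open>l\<^sub>1 > n\<close> as the full sum minus the sum over \<open>l\<^sub>1 \<le> n\<close> gives
  \<open>S\<^sub>n(m\<^sub>1,\<dots>,m\<^sub>p) = ti\<^bsub>m\<^sub>p,\<dots>,m\<^sub>1\<^esub>(x) - \<Sum>\<^bsub>l\<le>n\<^esub> S\<^sub>l(m\<^sub>2,\<dots>,m\<^sub>p) / (2l-1)\<^bsup>m\<^sub>1\<^esup>\<close>,
  and the formula follows by induction on \<open>p\<close>.
\<close>

section \<open>Iterated integrals over scaled simplices\<close>

text \<open>The upper end \<open>u\<close> varies because fixing the largest coordinate leaves a
  simplex of the same kind with that coordinate as its upper end.\<close>

definition scaled_simplex :: "nat \<Rightarrow> real \<Rightarrow> (nat \<Rightarrow> real) set" where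
  "scaled_simplex q u = {s. (\<forall>i<q. 0 < s i \<and> s i < u) \<and> (\<forall>i j. i < j \<and> j < q \<longrightarrow> s i < s j)}"

definition simplex_integrand :: "(real \<Rightarrow> complex) list \<Rightarrow> real \<Rightarrow> (nat \<Rightarrow> real) \<Rightarrow> complex" where
  "simplex_integrand gs u s =
     indicator (scaled_simplex (length gs) u) s *\<^sub>R (\<Prod>i<length gs. (gs ! i) (s i))"

definition simplex_integral :: "(real \<Rightarrow> complex) list \<Rightarrow> real \<Rightarrow> complex" where
  "simplex_integral gs u =
     integral\<^sup>L (PiM {..<length gs} (\<lambda>_. lborel)) (simplex_integrand gs u)"

interpretation lborels: product_sigma_finite "\<lambda>_::nat. lborel :: real measure"
  by standard

lemma simplex_integrand_cong:
  assumes "\<And>i. i < length gs \<Longrightarrow> s i = s' i"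
  shows "simplex_integrand gs u s = simplex_integrand gs u s'"
proof -
  have "s \<in> scaled_simplex (length gs) u \<longleftrightarrow> s' \<in> scaled_simplex (length gs) u"
    using assms unfolding scaled_simplex_def mem_Collect_eq
    by (intro conj_cong all_cong1 imp_cong refl) auto
  then show ?thesis
    using assms by (simp add: simplex_integrand_def indicator_def)
qed

text \<open>Coordinates increase, so the last one is the largest: it alone meets the bound
  \<open>u\<close>, and it bounds all the others.\<close>

lemma simplex_integrand_snoc:
  assumes "s (length gs) = y"
  shows "simplex_integrand (gs @ [g]) u s =
    indicator {0<..<u} y *\<^sub>R (g y * simplex_integrand gs y s)"
proof -
  have "s \<in> scaled_simplex (Suc (length gs)) u \<longleftrightarrow> 0 < y \<and> y < u \<and> s \<in> scaled_simplex (length gs) y"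
    using assms unfolding scaled_simplex_def
    by (auto simp: less_Suc_eq)
  then show ?thesis using assms
    by (auto simp: simplex_integrand_def indicator_def nth_append intro!: prod.cong)
qed

lemma measurable_simplex_integrand_pair:
  assumes "\<And>g. g \<in> set gs \<Longrightarrow> g \<in> borel_measurable borel"
  shows "(\<lambda>(y, s). simplex_integrand gs y s)
    \<in> borel_measurable (borel \<Otimes>\<^sub>M PiM {..<length gs} (\<lambda>_. lborel))"
proof -
  let ?M = "(borel :: real measure) \<Otimes>\<^sub>M PiM {..<length gs} (\<lambda>_. lborel)"
  have comp [measurable]: "(\<lambda>p. snd p i) \<in> borel_measurable ?M" if "i < length gs" for i
    using that by (intro measurable_compose[OF measurable_snd]) (simp add: measurable_component_singleton)
  have g: "(\<lambda>p. (gs ! i) (snd p i)) \<in> borel_measurable ?M" if "i < length gs" for i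
    using that by (intro measurable_compose[OF comp assms]) auto
  \<comment> \<open>The simplex is rewritten with quantifiers over finite index sets, under which
    measurable predicates are closed.\<close>
  have "Measurable.pred ?M (\<lambda>p. (\<forall>i\<in>{..<length gs}. 0 < snd p i \<and> snd p i < fst p) \<and>
     (\<forall>j\<in>{..<length gs}. \<forall>i\<in>{..<j}. snd p i < snd p j))"
    by (intro pred_intros_logic(3) pred_intros_finite(3) finite_lessThan)
       (auto intro!: borel_measurable_pred_less comp)
  moreover have "((\<forall>i\<in>{..<length gs}. 0 < snd p i \<and> snd p i < fst p) \<and>
     (\<forall>j\<in>{..<length gs}. \<forall>i\<in>{..<j}. snd p i < snd p j)) = (snd p \<in> scaled_simplex (length gs) (fst p))" for p
    by (auto simp: scaled_simplex_def)
  ultimately have [measurable]: "Measurable.pred ?M (\<lambda>p. snd p \<in> scaled_simplex (length gs) (fst p))"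
    by simp
  have [measurable]: "(\<lambda>p. \<Prod>i<length gs. (gs ! i) (snd p i)) \<in> borel_measurable ?M"
    by (intro borel_measurable_prod g) auto
  have "(\<lambda>p. if snd p \<in> scaled_simplex (length gs) (fst p) then (\<Prod>i<length gs. (gs ! i) (snd p i)) else 0)
      \<in> borel_measurable ?M"
    by measurable
  then show ?thesis
    by (rule back_subst[where P="\<lambda>f. f \<in> borel_measurable ?M"])
       (auto simp: simplex_integrand_def fun_eq_iff)
qed

lemma measurable_simplex_integrand:
  assumes "\<And>g. g \<in> set gs \<Longrightarrow> g \<in> borel_measurable borel"
  shows "simplex_integrand gs u \<in> borel_measurable (PiM {..<length gs} (\<lambda>_. lborel))"
  using measurable_compose[OF _ measurable_simplex_integrand_pair[OF assms],
      of "\<lambda>s. (u, s)" "PiM {..<length gs} (\<lambda>_. lborel)"]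
  by simp

lemma measurable_simplex_integral:
  assumes "\<And>g. g \<in> set gs \<Longrightarrow> g \<in> borel_measurable borel"
  shows "simplex_integral gs \<in> borel_measurable borel"
proof -
  interpret sigma_finite_measure "PiM {..<length gs} (\<lambda>_. lborel :: real measure)"
    by (rule lborels.sigma_finite) simp
  show ?thesis unfolding simplex_integral_def
    by (rule borel_measurable_lebesgue_integral) (use measurable_simplex_integrand_pair[OF assms] in simp)
qed

text \<open>Under this hypothesis the iterated integral up to \<open>u\<close> is \<open>O(u)\<close>, which absorbs the
  singularity \<open>1/s\<close> of the next form.\<close>
definition admissible :: "real \<Rightarrow> (real \<Rightarrow> complex) list \<Rightarrow> bool" where
  "admissible K gs \<longleftrightarrow> gs \<noteq> [] \<and> 0 \<le> K \<and>
     (\<forall>g\<in>set gs. g \<in> borel_measurable borel \<and> (\<forall>s\<in>{0<..<1}. norm (g s) \<le> K / s)) \<and>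
     (\<forall>s\<in>{0<..<1}. norm (hd gs s) \<le> K)"

text \<open>Tonelli for the last coordinate; it yields the integrability on which Fubini depends in
  \<open>simplex_integral_snoc\<close>.\<close>

lemma nn_integral_simplex_snoc:
  assumes "\<And>h. h \<in> set (gs @ [g]) \<Longrightarrow> h \<in> borel_measurable borel"
  shows "(\<integral>\<^sup>+s. ennreal (norm (simplex_integrand (gs @ [g]) u s)) \<partial>PiM {..<length (gs @ [g])} (\<lambda>_. lborel))
    = (\<integral>\<^sup>+y. indicator {0<..<u} y * (ennreal (norm (g y)) *
       (\<integral>\<^sup>+s. ennreal (norm (simplex_integrand gs y s)) \<partial>PiM {..<length gs} (\<lambda>_. lborel))) \<partial>lborel)"
proof -
  have ins: "{..<length (gs @ [g])} = insert (length gs) {..<length gs}" by auto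
  note [measurable] = measurable_simplex_integrand[of "gs @ [g]" u, OF assms, unfolded ins]
  have [measurable]: "simplex_integrand gs y \<in> borel_measurable (PiM {..<length gs} (\<lambda>_. lborel))" for y
    using assms by (intro measurable_simplex_integrand) auto
  have "simplex_integrand (gs @ [g]) u (s(length gs := y)) =
      indicator {0<..<u} y *\<^sub>R (g y * simplex_integrand gs y s)" for s y
    using simplex_integrand_cong[of gs "s(length gs := y)" s]
    by (subst simplex_integrand_snoc) auto
  then show ?thesis unfolding ins
    by (subst lborels.product_nn_integral_insert_rev)
       (auto simp: indicator_def norm_mult ennreal_mult' nn_integral_cmult intro!: nn_integral_cong)
qed

text \<open>The inner integral up to \<open>y\<close> is at most \<open>K ^ q * y\<close>, and this
  \<open>y\<close> cancels the one in the bound \<open>K / y\<close> of the next form. A constant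
  remains on \<open>(0, u)\<close>, which gives the factor \<open>u\<close> again.\<close>

lemma nn_integral_simplex_le:
  assumes "admissible K gs" "0 < u" "u \<le> 1"
  shows "(\<integral>\<^sup>+s. ennreal (norm (simplex_integrand gs u s)) \<partial>PiM {..<length gs} (\<lambda>_. lborel))
    \<le> ennreal (K ^ length gs * u)"
  using assms
proof (induction gs arbitrary: u rule: rev_induct)
  case Nil
  then show ?case by (simp add: admissible_def)
next
  case (snoc g gs)
  have K: "0 \<le> K" and meas: "\<And>h. h \<in> set (gs @ [g]) \<Longrightarrow> h \<in> borel_measurable borel"
    using snoc.prems by (auto simp: admissible_def)
  have "indicator {0<..<u} y * (ennreal (norm (g y)) *
       (\<integral>\<^sup>+s. ennreal (norm (simplex_integrand gs y s)) \<partial>PiM {..<length gs} (\<lambda>_. lborel)))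
      \<le> ennreal (K ^ length (gs @ [g])) * indicator {0<..<u} y" for y
  proof (cases "0 < y \<and> y < u")
    case True
    then have y: "0 < y" "y < 1" using snoc.prems by auto
    show ?thesis
    proof (cases "gs = []")
      case True
      \<comment> \<open>The empty inner integral is 1 and has no factor \<open>y\<close> to spare;
        here \<open>g\<close> is the head, which is bounded by \<open>K\<close> itself.\<close>
      have "norm (g y) \<le> K" using snoc.prems y True by (auto simp: admissible_def)
      then show ?thesis using True \<open>0 < y \<and> y < u\<close> K
        by (simp add: PiM_empty simplex_integrand_def scaled_simplex_def ennreal_leI)
    next
      case False
      then have "admissible K gs" using snoc.prems by (auto simp: admissible_def)
      then have "(\<integral>\<^sup>+s. ennreal (norm (simplex_integrand gs y s)) \<partial>PiM {..<length gs} (\<lambda>_. lborel))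
        \<le> ennreal (K ^ length gs * y)" using snoc.IH y by simp
      moreover have "norm (g y) \<le> K / y" using snoc.prems y by (auto simp: admissible_def)
      ultimately have "ennreal (norm (g y)) *
       (\<integral>\<^sup>+s. ennreal (norm (simplex_integrand gs y s)) \<partial>PiM {..<length gs} (\<lambda>_. lborel))
        \<le> ennreal (K / y) * ennreal (K ^ length gs * y)"
        by (intro mult_mono ennreal_leI) auto
      also have "\<dots> = ennreal (K ^ length (gs @ [g]))"
        using y K by (subst ennreal_mult[symmetric]) auto
      finally show ?thesis using True by simp
    qed
  qed (auto simp: indicator_def)
  then have "(\<integral>\<^sup>+y. indicator {0<..<u} y * (ennreal (norm (g y)) *
       (\<integral>\<^sup>+s. ennreal (norm (simplex_integrand gs y s)) \<partial>PiM {..<length gs} (\<lambda>_. lborel))) \<partial>lborel)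
     \<le> (\<integral>\<^sup>+y. ennreal (K ^ length (gs @ [g])) * indicator {0<..<u} y \<partial>lborel)"
    by (intro nn_integral_mono)
  also have "\<dots> = ennreal (K ^ length (gs @ [g]) * u)"
    using K snoc.prems by (subst nn_integral_cmult_indicator) (auto simp: ennreal_mult)
  finally show ?case by (subst nn_integral_simplex_snoc[OF meas])
qed

lemma integrable_simplex_integrand:
  assumes "admissible K gs" "0 < u" "u \<le> 1"
  shows "integrable (PiM {..<length gs} (\<lambda>_. lborel)) (simplex_integrand gs u)"
  unfolding integrable_iff_bounded
  using nn_integral_simplex_le[OF assms] measurable_simplex_integrand[of gs u] assms(1)
  by (auto simp: admissible_def intro: le_less_trans)

lemma norm_simplex_integral_le:
  assumes "admissible K gs" "0 < u" "u \<le> 1"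
  shows "norm (simplex_integral gs u) \<le> K ^ length gs * u"
proof -
  have "ennreal (norm (simplex_integral gs u)) \<le> ennreal (K ^ length gs * u)"
    unfolding simplex_integral_def
    using integral_norm_bound_ennreal[OF integrable_simplex_integrand[OF assms]]
      nn_integral_simplex_le[OF assms] by (rule order_trans)
  then show ?thesis using assms by (subst (asm) ennreal_le_iff) (auto simp: admissible_def)
qed

lemma simplex_integral_snoc:
  assumes adm: "admissible K (gs @ [g])" and u: "0 < u" "u \<le> 1"
  shows "simplex_integral (gs @ [g]) u = (LINT y : {0<..<u} | lborel. g y * simplex_integral gs y)"
proof -
  let ?q = "length gs"
  have ins: "{..<length (gs @ [g])} = {?q} \<union> {..<?q}" by auto
  have meas: "\<And>h. h \<in> set (gs @ [g]) \<Longrightarrow> h \<in> borel_measurable borel"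
    using adm by (auto simp: admissible_def)
  have [measurable]: "g \<in> borel_measurable borel" "simplex_integral gs \<in> borel_measurable borel"
    using meas measurable_simplex_integral[of gs] by auto
  have "simplex_integral (gs @ [g]) u = (\<integral>x. (\<integral>s. simplex_integrand (gs @ [g]) u
      (merge {?q} {..<?q} (x, s)) \<partial>PiM {..<?q} (\<lambda>_. lborel)) \<partial>PiM {?q} (\<lambda>_. lborel))"
    using integrable_simplex_integrand[OF adm u]
    unfolding simplex_integral_def ins by (intro lborels.product_integral_fold) auto
  also have "\<dots> = (\<integral>x. indicator {0<..<u} (x ?q) *\<^sub>R (g (x ?q) * simplex_integral gs (x ?q))
      \<partial>PiM {?q} (\<lambda>_. lborel))"
  proof (intro Bochner_Integration.integral_cong refl)
    fix x :: "nat \<Rightarrow> real"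
    have "simplex_integrand (gs @ [g]) u (merge {?q} {..<?q} (x, s)) =
       indicator {0<..<u} (x ?q) *\<^sub>R (g (x ?q) * simplex_integrand gs (x ?q) s)" for s
      by (subst simplex_integrand_snoc[where y="x ?q"], simp add: merge_def)
         (subst simplex_integrand_cong[where s'=s], auto simp: merge_def)
    then show "(\<integral>s. simplex_integrand (gs @ [g]) u
      (merge {?q} {..<?q} (x, s)) \<partial>PiM {..<?q} (\<lambda>_. lborel)) =
      indicator {0<..<u} (x ?q) *\<^sub>R (g (x ?q) * simplex_integral gs (x ?q))"
      by (simp add: simplex_integral_def)
  qed
  also have "\<dots> = (LINT y : {0<..<u} | lborel. g y * simplex_integral gs y)"
    unfolding set_lebesgue_integral_def
    by (rule lborels.product_integral_singleton) measurable
  finally show ?thesis .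
qed

lemma simplex_integral_single:
  assumes adm: "admissible K [g]" and u: "0 < u" "u \<le> 1"
  shows "simplex_integral [g] u = (LINT y : {0<..<u} | lborel. g y)"
proof -
  have "simplex_integral [] y = 1" for y
    by (simp add: simplex_integral_def PiM_empty simplex_integrand_def scaled_simplex_def
      lebesgue_integral_count_space_finite)
  then show ?thesis using simplex_integral_snoc[of K "[]" g u] assms by simp
qed

text \<open>Boundedness makes \<open>f\<close> Lebesgue integrable, so the integral agrees with the
  gauge integral, whose fundamental theorem accepts a primitive continuous up to the endpoints and
  differentiable inside.\<close>

lemma LINT_Ioo_FTC:
  fixes f F :: "real \<Rightarrow> complex"
  assumes u: "0 < u" and f: "f \<in> borel_measurable borel"
    and bd: "\<And>t. 0 < t \<Longrightarrow> t < u \<Longrightarrow> norm (f t) \<le> B"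
    and cont: "continuous_on {0..u} F"
    and deriv: "\<And>t. 0 < t \<Longrightarrow> t < u \<Longrightarrow> (F has_vector_derivative f t) (at t)"
  shows "(LINT t : {0<..<u} | lborel. f t) = F u - F 0"
proof -
  have "set_integrable lborel {0<..<u} f"
    unfolding set_integrable_def
  proof (rule Bochner_Integration.integrable_bound)
    show "integrable lborel (\<lambda>t. indicator {0<..<u} t *\<^sub>R B)"
      using u by (intro integrable_scaleR_left) auto
    show "(\<lambda>t. indicator {0<..<u} t *\<^sub>R f t) \<in> borel_measurable lborel" using f by measurable
    show "AE t in lborel. norm (indicator {0<..<u} t *\<^sub>R f t) \<le> norm (indicator {0<..<u} t *\<^sub>R B)"
      using bd by (intro AE_I2) (auto simp: indicator_def intro: order_trans[OF _ abs_ge_self])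
  qed
  then have "(LINT t : {0<..<u} | lborel. f t) = integral {0<..<u} f"
    by (rule set_borel_integral_eq_integral)
  also have "(f has_integral F u - F 0) {0..u}"
    using u cont deriv by (intro fundamental_theorem_of_calculus_interior) auto
  then have "integral {0<..<u} f = F u - F 0"
    by (simp add: has_integral_Icc_iff_Ioo integral_unique)
  finally show ?thesis .
qed

section \<open>Iterated integrals as primitives on the unit disc\<close>

text \<open>The factor \<open>x\<close> comes from \<open>dt = x ds\<close> on the segment
  \<open>t = s x\<close>; over all forms these factors absorb the power
  \<open>(b - a) ^ length fs\<close> of \<open>iint\<close>.\<close>

definition pullback :: "complex \<Rightarrow> (complex \<Rightarrow> complex) \<Rightarrow> real \<Rightarrow> complex" where
  "pullback x f s = f (of_real s * x) * x"

lemma iint_eq_simplex_integral: "iint 0 x fs = simplex_integral (map (pullback x) fs) 1"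
proof -
  have "osimplex q = scaled_simplex q 1" for q
    by (auto simp: osimplex_def scaled_simplex_def)
  then have "x ^ length fs * (indicator (osimplex (length fs)) s *\<^sub>R
      (\<Prod>i<length fs. (fs ! i) (0 + of_real (s i) * (x - 0)))) =
    simplex_integrand (map (pullback x) fs) 1 s" for s
    by (simp add: simplex_integrand_def pullback_def prod.distrib)
  then show ?thesis
    by (simp add: iint_def simplex_integral_def set_lebesgue_integral_def
        flip: integral_mult_right_zero)
qed

text \<open>The identity is kept along the whole segment, not only at its end, so that a further
  form can be integrated against \<open>P\<close>. The constant \<open>c\<close> is the factor
  \<open>2n\<close> or \<open>2n - 1\<close> in front of the integral.\<close>

definition represents :: "complex \<Rightarrow> real \<Rightarrow> complex \<Rightarrow> (complex \<Rightarrow> complex) list \<Rightarrow> (complex \<Rightarrow> complex) \<Rightarrow> bool"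
  where "represents x K c fs P \<longleftrightarrow> admissible K (map (pullback x) fs) \<and>
    (\<forall>u. 0 < u \<longrightarrow> u \<le> 1 \<longrightarrow> c * simplex_integral (map (pullback x) fs) u = P (of_real u * x))"

lemma represents_iint: "represents x K c fs P \<Longrightarrow> c * iint 0 x fs = P x"
  by (simp add: represents_def iint_eq_simplex_integral)

lemma of_real_mult_in_ball:
  fixes x :: complex
  assumes "norm x < 1" "0 \<le> u" "u \<le> 1"
  shows "of_real u * x \<in> ball 0 1"
proof -
  have "\<bar>u\<bar> * norm x \<le> 1 * norm x" using assms by (intro mult_right_mono) auto
  then show ?thesis using assms by (simp add: norm_mult)
qed

lemma LINT_pullback_FTC:
  fixes x :: complex and g :: "real \<Rightarrow> complex"
  assumes x: "norm x < 1" and u: "0 < u" "u \<le> 1"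
    and meas: "g \<in> borel_measurable borel"
    and bd: "\<And>t. 0 < t \<Longrightarrow> t < u \<Longrightarrow> norm (g t) \<le> B"
    and Q: "\<And>z. z \<in> ball 0 1 \<Longrightarrow> (Q has_field_derivative q z) (at z)"
    and q: "\<And>t. 0 < t \<Longrightarrow> t < u \<Longrightarrow> g t = q (of_real t * x) * x"
  shows "(LINT t : {0<..<u} | lborel. g t) = Q (of_real u * x) - Q 0"
proof -
  have deriv: "((\<lambda>t. Q (of_real t * x)) has_vector_derivative q (of_real t * x) * x) (at t)"
    if "0 \<le> t" "t \<le> u" for t
  proof -
    have "((\<lambda>t::real. of_real t * x) has_vector_derivative x) (at t)"
      by (auto intro!: derivative_eq_intros simp: has_vector_derivative_def scaleR_conv_of_real)
    moreover have "of_real t * x \<in> ball 0 1"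
      using that u x by (intro of_real_mult_in_ball) auto
    ultimately show ?thesis
      using field_vector_diff_chain_at[OF _ Q] by (fastforce simp: o_def mult.commute)
  qed
  have "continuous_on {0..u} (\<lambda>t. Q (of_real t * x))"
    by (intro continuous_at_imp_continuous_on ballI has_vector_derivative_continuous[OF deriv]) auto
  then have "(LINT t : {0<..<u} | lborel. g t) = Q (of_real u * x) - Q (of_real 0 * x)"
    using u meas bd deriv q by (intro LINT_Ioo_FTC[where B=B]) auto
  then show ?thesis by simp
qed

lemma measurable_pullback:
  assumes "f \<in> borel_measurable borel"
  shows "pullback x f \<in> borel_measurable borel"
proof -
  note [measurable] = assms
  show ?thesis unfolding pullback_def[abs_def] by measurable
qed

lemma represents_single:
  assumes x: "norm x < 1" and meas: "f \<in> borel_measurable borel"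
    and bd: "\<And>s. 0 < s \<Longrightarrow> s < 1 \<Longrightarrow> norm (pullback x f s) \<le> K"
    and Q: "\<And>z. z \<in> ball 0 1 \<Longrightarrow> (Q has_field_derivative c * f z) (at z)" and Q0: "Q 0 = 0"
  shows "represents x K c [f] Q"
proof -
  have K: "0 \<le> K" using norm_ge_zero bd[of "1/2"] by (rule order_trans) auto
  have "K \<le> K / s" if "0 < s" "s < 1" for s
    using that K by (simp add: field_simps mult_left_le)
  then have adm: "admissible K [pullback x f]"
    using bd K measurable_pullback[OF meas] by (auto simp: admissible_def intro!: order_trans[OF bd])
  have "c * simplex_integral [pullback x f] u = Q (of_real u * x)" if u: "0 < u" "u \<le> 1" for u
  proof -
    have "c * simplex_integral [pullback x f] u = (LINT t : {0<..<u} | lborel. c * pullback x f t)"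
      using simplex_integral_single[OF adm u] by simp
    also have "\<dots> = Q (of_real u * x) - Q 0"
    proof (rule LINT_pullback_FTC[OF x u _ _ Q])
      show "(\<lambda>t. c * pullback x f t) \<in> borel_measurable borel"
        using measurable_pullback[OF meas, of x] by measurable
      show "norm (c * pullback x f t) \<le> norm c * K" if "0 < t" "t < u" for t
        unfolding norm_mult using that u bd by (intro mult_left_mono) auto
    qed (simp_all add: pullback_def)
    finally show ?thesis using Q0 by simp
  qed
  then show ?thesis using adm by (simp add: represents_def)
qed

text \<open>Appending a form amounts to finding a primitive of \<open>f P\<close> that vanishes at
  0. The derivative \<open>q\<close> is a separate function because for \<open>f = 1 / t\<close> the
  product has a removable singularity at 0, where division by zero would give the wrong
  value.\<close>

lemma represents_snoc:
  assumes x: "norm x < 1" and P: "represents x K c fs P"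
    and meas: "f \<in> borel_measurable borel"
    and bd: "\<And>s. 0 < s \<Longrightarrow> s < 1 \<Longrightarrow> norm (pullback x f s) \<le> K / s"
    and Q: "\<And>z. z \<in> ball 0 1 \<Longrightarrow> (Q has_field_derivative q z) (at z)" and Q0: "Q 0 = 0"
    and q: "\<And>z. z \<in> ball 0 1 \<Longrightarrow> z \<noteq> 0 \<Longrightarrow> q z = f z * P z"
  shows "represents x K c (fs @ [f]) Q"
proof -
  let ?gs = "map (pullback x) fs"
  have adm: "admissible K ?gs" and
    P': "\<And>u. 0 < u \<Longrightarrow> u \<le> 1 \<Longrightarrow> c * simplex_integral ?gs u = P (of_real u * x)"
    using P by (auto simp: represents_def)
  have K: "0 \<le> K"
    using adm by (auto simp: admissible_def)
  have adm': "admissible K (?gs @ [pullback x f])"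
    using adm bd measurable_pullback[OF meas] by (auto simp: admissible_def)
  have meas': "simplex_integral ?gs \<in> borel_measurable borel"
    using adm by (intro measurable_simplex_integral) (auto simp: admissible_def)
  have "c * simplex_integral (?gs @ [pullback x f]) u = Q (of_real u * x)" if u: "0 < u" "u \<le> 1" for u
  proof -
    have "c * simplex_integral (?gs @ [pullback x f]) u =
        (LINT t : {0<..<u} | lborel. c * (pullback x f t * simplex_integral ?gs t))"
      using simplex_integral_snoc[OF adm' u] by simp
    also have "\<dots> = Q (of_real u * x) - Q 0"
    proof (rule LINT_pullback_FTC[OF x u _ _ Q])
      show "(\<lambda>t. c * (pullback x f t * simplex_integral ?gs t)) \<in> borel_measurable borel"
        using meas' measurable_pullback[OF meas, of x] by measurable
      fix t assume t: "0 < t" "t < u"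
      have "norm (pullback x f t * simplex_integral ?gs t) \<le> (K / t) * (K ^ length ?gs * t)"
        unfolding norm_mult using t u K
        by (intro mult_mono bd norm_simplex_integral_le[OF adm]) auto
      also have "\<dots> = K ^ Suc (length fs)" using t by simp
      finally show "norm (c * (pullback x f t * simplex_integral ?gs t)) \<le> norm c * K ^ Suc (length fs)"
        unfolding norm_mult by (intro mult_left_mono) auto
      show "c * (pullback x f t * simplex_integral ?gs t) = q (of_real t * x) * x"
      \<comment> \<open>If \<open>x = 0\<close>, the segment stays at 0, where \<open>q\<close> is
        not tied to \<open>f P\<close>; the Jacobian factor \<open>x\<close> makes both sides
        vanish.\<close>
      proof (cases "x = 0")
        case False
        then have "of_real t * x \<noteq> 0" "of_real t * x \<in> ball 0 1"
          using t u of_real_mult_in_ball[OF x, of t] by auto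
        then show ?thesis using q P'[of t] t u by (simp add: pullback_def mult_ac)
      qed (simp add: pullback_def)
    qed auto
    finally show ?thesis using Q0 by simp
  qed
  then show ?thesis using adm' by (simp add: represents_def)
qed

section \<open>Odd power series\<close>

definition odd_series :: "(nat \<Rightarrow> real) \<Rightarrow> complex \<Rightarrow> complex" where
  "odd_series c z = (\<Sum>k. of_real (c k) * z ^ (2 * k + 1))"

lemma summable_bounded_coeffs:
  fixes w :: complex
  assumes "\<And>k. \<bar>c k\<bar> \<le> (B::real)" "norm w < 1"
  shows "summable (\<lambda>k. of_real (c k) * w ^ k)"
proof (rule summable_norm_cancel, rule summable_comparison_test')
  show "summable (\<lambda>k. B * norm w ^ k)" using assms(2) by (intro summable_mult summable_geometric) auto
  show "norm (norm (of_real (c k) * w ^ k)) \<le> B * norm w ^ k" for k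
    using assms(1) by (auto simp: norm_mult norm_power intro!: mult_right_mono)
qed

lemma norm_power2_less_1: "norm z < 1 \<Longrightarrow> norm (z\<^sup>2 :: complex) < 1"
  by (simp add: norm_power abs_square_less_1)

text \<open>Factoring out \<open>z\<close> leaves an ordinary power series in \<open>z^2\<close>, to
  which the convergence and termwise differentiation theorems apply.\<close>

lemma odd_series_eq:
  assumes "\<And>k. \<bar>c k\<bar> \<le> (B::real)" "norm z < 1"
  shows "odd_series c z = z * (\<Sum>k. of_real (c k) * (z\<^sup>2) ^ k)"
    and "summable (\<lambda>k. of_real (c k) * z ^ (2 * k + 1))"
proof -
  have s: "summable (\<lambda>k. of_real (c k) * (z\<^sup>2) ^ k)"
    using assms by (intro summable_bounded_coeffs norm_power2_less_1)
  show "odd_series c z = z * (\<Sum>k. of_real (c k) * (z\<^sup>2) ^ k)"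
    unfolding odd_series_def by (subst suminf_mult[OF s, symmetric]) (simp add: power_mult[symmetric] mult_ac)
  show "summable (\<lambda>k. of_real (c k) * z ^ (2 * k + 1))"
    using summable_mult[OF s, of z] by (simp add: power_mult[symmetric] mult_ac)
qed

text \<open>With \<open>w = z^2\<close> and \<open>G\<close> the power series of \<open>c\<close>,
  this is the derivative \<open>G(w) + 2 w G'(w)\<close> of \<open>z G(z^2)\<close>;
  \<open>diffs\<close> gives the coefficients of \<open>G'\<close>.\<close>

lemma sums_odd_weighted:
  fixes w :: complex
  assumes c: "\<And>k. \<bar>c k\<bar> \<le> (B::real)" and w: "norm w < 1"
  shows "(\<lambda>k. of_real ((2 * real k + 1) * c k) * w ^ k) sums
     ((\<Sum>k. of_real (c k) * w ^ k) + 2 * w * (\<Sum>k. diffs (\<lambda>k. of_real (c k)) k * w ^ k))"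
proof -
  have "summable (\<lambda>k. diffs (\<lambda>k. of_real (c k) :: complex) k * w ^ k)"
    by (rule termdiff_converges[OF w]) (rule summable_bounded_coeffs[OF c])
  from sums_mult[OF diffs_equiv[OF this], of "2 * w"]
  moreover have "2 * w * (of_nat k * of_real (c k) * w ^ (k - Suc 0)) =
      of_real (2 * real k * c k) * w ^ k" for k by (cases k) (simp_all add: mult_ac)
  ultimately have "(\<lambda>k. of_real (2 * real k * c k) * w ^ k) sums (2 * w * (\<Sum>k. diffs (\<lambda>k. of_real (c k)) k * w ^ k))"
    by (simp only:)
  from sums_add[OF summable_sums[OF summable_bounded_coeffs[OF c w]] this]
  show ?thesis by (simp add: algebra_simps)
qed

lemma has_field_derivative_odd_series:
  assumes c: "\<And>k. \<bar>c k\<bar> \<le> (B::real)" and z: "z \<in> ball 0 1"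
  shows "(odd_series c has_field_derivative (\<Sum>k. of_real ((2 * real k + 1) * c k) * (z\<^sup>2) ^ k)) (at z)"
proof -
  have z1: "norm z < 1" using z by simp
  let ?G = "\<lambda>w. \<Sum>k. complex_of_real (c k) * w ^ k"
  have "(?G has_field_derivative (\<Sum>k. diffs (\<lambda>k. of_real (c k)) k * (z\<^sup>2) ^ k)) (at (z\<^sup>2))"
    by (rule termdiffs_strong'[OF summable_bounded_coeffs[OF c] norm_power2_less_1[OF z1]])
  then have "((\<lambda>z. ?G (z\<^sup>2)) has_field_derivative
      (\<Sum>k. diffs (\<lambda>k. of_real (c k)) k * (z\<^sup>2) ^ k) * (2 * z)) (at z)"
    by (rule DERIV_chain2) (auto intro!: derivative_eq_intros)
  from DERIV_mult[OF DERIV_ident this]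
  have "((\<lambda>z. z * ?G (z\<^sup>2)) has_field_derivative
      (\<Sum>k. of_real ((2 * real k + 1) * c k) * (z\<^sup>2) ^ k)) (at z)"
    unfolding sums_unique[OF sums_odd_weighted[OF c norm_power2_less_1[OF z1]], symmetric]
    by (simp add: algebra_simps power2_eq_square)
  then show ?thesis
    by (rule has_field_derivative_transform_within_open[OF _ open_ball z])
       (use odd_series_eq(1)[OF c] in auto)
qed

text \<open>Effect of a block \<open>t dt/(1-t^2) (dt/t)^(m-1)\<close> on the coefficients:
  multiplication by \<open>w / (1 - w)\<close>, where \<open>w = z^2\<close>, produces the strict
  partial sums, and each of the \<open>m\<close> integrations divides by
  \<open>2k + 1\<close>.\<close>

definition blockstep :: "(nat \<Rightarrow> real) \<Rightarrow> nat \<Rightarrow> nat \<Rightarrow> real" where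
  "blockstep c m k = (\<Sum>j<k. c j) / (2 * real k + 1) ^ m"

lemma abs_divide_power_le:
  assumes "\<bar>a\<bar> \<le> B"
  shows "\<bar>a / (2 * real k + 1) ^ m\<bar> \<le> B"
proof -
  have "\<bar>a\<bar> * 1 \<le> B * (2 * real k + 1) ^ m" using assms by (intro mult_mono) auto
  then show ?thesis by (simp add: abs_mult field_simps)
qed

text \<open>A sum of \<open>k\<close> terms is divided by at least \<open>2k + 1\<close>, so blocks
  preserve bounded coefficients and hence convergence on the unit disc.\<close>

lemma blockstep_le:
  assumes "\<And>k. \<bar>c k\<bar> \<le> B" "1 \<le> m"
  shows "\<bar>blockstep c m k\<bar> \<le> B"
proof -
  have B: "0 \<le> B" using assms(1)[of 0] by linarith
  have "\<bar>\<Sum>j<k. c j\<bar> \<le> (\<Sum>j<k. B)" by (rule order_trans[OF sum_abs sum_mono]) (rule assms)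
  also have "\<dots> = real k * B" by simp
  also have "\<dots> \<le> (2 * real k + 1) * B" using B by (intro mult_right_mono) auto
  finally have "\<bar>(\<Sum>j<k. c j) / (2 * real k + 1)\<bar> \<le> B" by (simp add: field_simps)
  from abs_divide_power_le[OF this, of k "m - 1"] show ?thesis
    using assms(2) by (cases m) (simp_all add: blockstep_def)
qed

text \<open>The derivative has the partial sums \<open>C k\<close> as coefficients in
  \<open>w = z^2\<close>. From \<open>C (Suc k) = C k + c k\<close> and \<open>C 0 = 0\<close>,
  their series times \<open>1 - w\<close> is \<open>w\<close> times the series of
  \<open>c\<close>.\<close>

lemma has_field_derivative_odd_series_blockstep:
  assumes c: "\<And>k. \<bar>c k\<bar> \<le> B" and z: "z \<in> ball 0 1"
  shows "(odd_series (blockstep c 1) has_field_derivative z / (1 - z\<^sup>2) * odd_series c z) (at z)"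
proof -
  define w where "w = z\<^sup>2"
  have z1: "norm z < 1" and w: "norm w < 1"
    using z norm_power2_less_1 by (auto simp: w_def)
  define C where "C k = (\<Sum>j<k. c j)" for k
  have b1: "\<bar>blockstep c 1 k\<bar> \<le> B" for k by (rule blockstep_le[OF c]) simp
  have C: "(2 * real k + 1) * blockstep c 1 k = C k" for k
    by (simp add: blockstep_def C_def)
  \<comment> \<open>The partial sums may grow linearly, so convergence comes from the weighted
    series of the bounded sequence \<open>blockstep c 1\<close>.\<close>
  have sC: "summable (\<lambda>k. of_real (C k) * w ^ k)"
    using sums_summable[OF sums_odd_weighted[of "blockstep c 1", OF b1 w]] unfolding C .
  have sc: "summable (\<lambda>k. of_real (c k) * w ^ k)" by (rule summable_bounded_coeffs[OF c w])
  have "(\<Sum>k. of_real (C k) * w ^ k) = (\<Sum>k. of_real (C (Suc k)) * w ^ Suc k)"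
    using suminf_split_head[OF sC] by (simp add: C_def)
  also have "\<dots> = (\<Sum>k. w * (of_real (C k) * w ^ k) + w * (of_real (c k) * w ^ k))"
    by (simp add: C_def algebra_simps)
  also have "\<dots> = w * (\<Sum>k. of_real (C k) * w ^ k) + w * (\<Sum>k. of_real (c k) * w ^ k)"
    by (subst suminf_add[symmetric]) (simp_all add: sC sc summable_mult suminf_mult)
  finally have "(\<Sum>k. of_real (C k) * w ^ k) * (1 - w) = w * (\<Sum>k. of_real (c k) * w ^ k)"
    by (simp add: algebra_simps)
  moreover have "1 - w \<noteq> 0" using w by auto
  ultimately have "(\<Sum>k. of_real (C k) * w ^ k) = z / (1 - z\<^sup>2) * odd_series c z"
    unfolding odd_series_eq(1)[OF c z1] w_def[symmetric]
    by (simp add: eq_divide_eq) (simp add: w_def power2_eq_square mult_ac)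
  then show ?thesis
    using has_field_derivative_odd_series[of "blockstep c 1", OF b1 z] unfolding C w_def by simp
qed

lemma odd_series_0 [simp]: "odd_series c 0 = 0"
  by (simp add: odd_series_def)

section \<open>Blocks of forms acting on odd series\<close>

text \<open>The constant \<open>1 / (1 - |x|^2)\<close> dominates \<open>1 / (1 - t^2)\<close> along
  the segment. Being at least 1, it also serves for \<open>dt/t\<close> and for the initial
  power.\<close>

lemma norm_pullback_le:
  assumes x: "norm x < 1" and s: "0 < s" "s < 1"
    and f: "norm (f (of_real s * x)) \<le> norm (1 / (1 - (of_real s * x)\<^sup>2))"
  shows "norm (pullback x f s) \<le> 1 / (1 - (norm x)\<^sup>2) / s"
proof -
  let ?z = "of_real s * x"
  have r: "(norm x)\<^sup>2 < 1" using x by (simp add: abs_square_less_1)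
  have "norm ?z \<le> 1 * norm x" using s unfolding norm_mult by (intro mult_right_mono) auto
  then have "(norm ?z)\<^sup>2 \<le> (norm x)\<^sup>2" by (intro power_mono) auto
  then have "1 - (norm x)\<^sup>2 \<le> norm (1 - ?z\<^sup>2)"
    using norm_triangle_ineq2[of 1 "?z\<^sup>2"] unfolding norm_power norm_one by linarith
  then have "norm (1 / (1 - ?z\<^sup>2)) \<le> 1 / (1 - (norm x)\<^sup>2)"
    using r unfolding norm_divide by (intro divide_mono) auto
  with f have "norm (f ?z) \<le> 1 / (1 - (norm x)\<^sup>2)" by linarith
  then have "norm (pullback x f s) \<le> 1 / (1 - (norm x)\<^sup>2) * 1"
    unfolding pullback_def norm_mult using x r by (intro mult_mono) auto
  also have "\<dots> \<le> 1 / (1 - (norm x)\<^sup>2) * (1 / s)"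
    using s r by (intro mult_left_mono) auto
  finally show ?thesis by simp
qed

text \<open>Dividing an odd series by \<open>z\<close> gives a power series in \<open>z^2\<close>,
  and integrating it back divides the coefficient with index \<open>k\<close> by
  \<open>2k + 1\<close>.\<close>

lemma represents_replicate:
  assumes x: "norm x < 1" and c: "\<And>k. \<bar>c k\<bar> \<le> 1"
    and P: "represents x (1 / (1 - (norm x)\<^sup>2)) a fs (odd_series c)"
  shows "represents x (1 / (1 - (norm x)\<^sup>2)) a (fs @ replicate p (\<lambda>t. 1 / t))
     (odd_series (\<lambda>k. c k / (2 * real k + 1) ^ p))"
proof (induction p)
  case 0
  then show ?case using P by simp
next
  case (Suc p)
  have r: "(norm x)\<^sup>2 < 1" using x by (simp add: abs_square_less_1)
  have bd: "\<bar>c k / (2 * real k + 1) ^ p\<bar> \<le> 1" for k p by (rule abs_divide_power_le) (rule c)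
  have "represents x (1 / (1 - (norm x)\<^sup>2)) a ((fs @ replicate p (\<lambda>t. 1 / t)) @ [\<lambda>t. 1 / t])
     (odd_series (\<lambda>k. c k / (2 * real k + 1) ^ Suc p))"
  proof (rule represents_snoc[OF x Suc])
    show "norm (pullback x (\<lambda>t. 1 / t) s) \<le> 1 / (1 - (norm x)\<^sup>2) / s" if "0 < s" "s < 1" for s
    proof -
      have "norm (pullback x (\<lambda>t. 1 / t) s) \<le> 1 / s"
        using that by (cases "x = 0") (auto simp: pullback_def norm_divide norm_mult)
      also have "\<dots> \<le> 1 / (1 - (norm x)\<^sup>2) / s"
        using that r by (intro divide_right_mono) (auto simp: field_simps)
      finally show ?thesis .
    qed
    fix z :: complex assume z: "z \<in> ball 0 1"
    have "(2 * real k + 1) * (c k / (2 * real k + 1) ^ Suc p) = c k / (2 * real k + 1) ^ p" for k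
      by simp
    then show "(odd_series (\<lambda>k. c k / (2 * real k + 1) ^ Suc p) has_field_derivative
       (\<Sum>k. of_real (c k / (2 * real k + 1) ^ p) * (z\<^sup>2) ^ k)) (at z)"
      using has_field_derivative_odd_series[of "\<lambda>k. c k / (2 * real k + 1) ^ Suc p", OF bd z] by simp
    assume "z \<noteq> 0"
    then show "(\<Sum>k. of_real (c k / (2 * real k + 1) ^ p) * (z\<^sup>2) ^ k) =
       1 / z * odd_series (\<lambda>k. c k / (2 * real k + 1) ^ p) z"
      using odd_series_eq(1)[OF bd] z by simp
  qed auto
  then show ?case by (simp add: replicate_append_same)
qed

text \<open>Only the product \<open>f P\<close> is prescribed: this covers \<open>t/(1-t^2)\<close>
  after an odd series as well as \<open>1/(1-t^2)\<close> after an even power.\<close>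

lemma represents_block:
  assumes x: "norm x < 1" and c: "\<And>k. \<bar>c k\<bar> \<le> 1"
    and P: "represents x (1 / (1 - (norm x)\<^sup>2)) a fs P" and m: "1 \<le> m"
    and meas: "f \<in> borel_measurable borel"
    and bd: "\<And>z. z \<in> ball 0 1 \<Longrightarrow> norm (f z) \<le> norm (1 / (1 - z\<^sup>2))"
    and eq: "\<And>z. z \<in> ball 0 1 \<Longrightarrow> f z * P z = z / (1 - z\<^sup>2) * odd_series c z"
  shows "represents x (1 / (1 - (norm x)\<^sup>2)) a (fs @ blk m f) (odd_series (blockstep c m))"
proof -
  have "represents x (1 / (1 - (norm x)\<^sup>2)) a (fs @ [f]) (odd_series (blockstep c 1))"
  proof (rule represents_snoc[OF x P meas])
    show "norm (pullback x f s) \<le> 1 / (1 - (norm x)\<^sup>2) / s" if "0 < s" "s < 1" for s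
      using that x bd of_real_mult_in_ball[of x s] by (intro norm_pullback_le) auto
    show "(odd_series (blockstep c 1) has_field_derivative z / (1 - z\<^sup>2) * odd_series c z) (at z)"
      if "z \<in> ball 0 1" for z
      using has_field_derivative_odd_series_blockstep[OF c that] .
  qed (use eq in auto)
  moreover have "\<bar>blockstep c 1 k\<bar> \<le> 1" for k by (rule blockstep_le[OF c]) simp
  moreover have "blockstep c m = (\<lambda>k. blockstep c 1 k / (2 * real k + 1) ^ (m - 1))"
    using m by (cases m) (simp_all add: blockstep_def fun_eq_iff)
  ultimately show ?thesis
    using represents_replicate[OF x, of "blockstep c 1" a "fs @ [f]" "m - 1"] by (simp add: blk_def)
qed

text \<open>The leftmost block is innermost, so the coefficients are transformed from left to right,
  by \<open>foldl\<close>.\<close>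

lemma represents_blocks:
  assumes x: "norm x < 1" and "\<And>k. \<bar>c k\<bar> \<le> 1"
    and "represents x (1 / (1 - (norm x)\<^sup>2)) a fs (odd_series c)" and "\<forall>m\<in>set ms. 1 \<le> m"
  shows "represents x (1 / (1 - (norm x)\<^sup>2)) a
     (fs @ concat (map (\<lambda>k. blk k (\<lambda>t. t / (1 - t\<^sup>2))) ms)) (odd_series (foldl blockstep c ms))"
  using assms(2-)
proof (induction ms arbitrary: c fs)
  case (Cons m ms)
  have "represents x (1 / (1 - (norm x)\<^sup>2)) a (fs @ blk m (\<lambda>t. t / (1 - t\<^sup>2))) (odd_series (blockstep c m))"
    using Cons.prems(3)
    by (intro represents_block[OF x Cons.prems(1,2)])
       (auto simp: norm_divide divide_right_mono)
  moreover have "\<bar>blockstep c m k\<bar> \<le> 1" for k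
    using Cons.prems(3) by (intro blockstep_le Cons.prems(1)) auto
  ultimately show ?case
    using Cons.IH[of "blockstep c m" "fs @ blk m (\<lambda>t. t / (1 - t\<^sup>2))"] Cons.prems(3) by simp
qed simp

lemma odd_series_delta: "odd_series (\<lambda>k. if k = n then 1 else 0) z = z ^ (2 * n + 1)"
proof -
  have "(\<lambda>k. of_real (if k = n then 1 else 0) * z ^ (2 * k + 1)) =
      (\<lambda>k. if k = n then z ^ (2 * k + 1) else 0)" by auto
  then show ?thesis
    unfolding odd_series_def using sums_unique[OF sums_single[of n "\<lambda>k. z ^ (2 * k + 1)"]] by simp
qed

lemma represents_power:
  assumes x: "norm x < 1"
  shows "represents x (1 / (1 - (norm x)\<^sup>2)) (of_nat (Suc p)) [\<lambda>t. t ^ p] (\<lambda>z. z ^ Suc p)"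
proof (rule represents_single[OF x])
  fix s :: real assume s: "0 < s" "s < 1"
  have r: "(norm x)\<^sup>2 < 1" using x by (simp add: abs_square_less_1)
  have "norm (of_real s * x) < 1" using of_real_mult_in_ball[OF x, of s] s by simp
  then have "norm (pullback x (\<lambda>t. t ^ p) s) \<le> 1 * 1"
    unfolding pullback_def norm_mult[of "_ ^ p"] norm_power using x
    by (intro mult_mono power_le_one) auto
  also have "\<dots> \<le> 1 / (1 - (norm x)\<^sup>2)" using r by (auto simp: field_simps)
  finally show "norm (pullback x (\<lambda>t. t ^ p) s) \<le> 1 / (1 - (norm x)\<^sup>2)" .
next
  show "((\<lambda>z. z ^ Suc p) has_field_derivative of_nat (Suc p) * z ^ p) (at z)" for z :: complex
    by (rule DERIV_cong, rule DERIV_power, rule DERIV_ident) simp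
qed auto

text \<open>This is \<open>S\<^bsub>n+1\<^esub>\<close>: the coefficient with index \<open>k\<close> belongs to the summation index \<open>l = k + 1\<close>.\<close>
definition tail_series :: "nat \<Rightarrow> nat list \<Rightarrow> complex \<Rightarrow> complex" where
  "tail_series n ms x = odd_series (foldl blockstep (\<lambda>k. if k = n then 1 else 0) ms) x"

lemma iint_even_start:
  assumes x: "norm x < 1" and ms: "\<forall>m\<in>set ms. 1 \<le> m"
  shows "of_nat (2 * n + 1) * iint 0 x ((\<lambda>t. t ^ (2 * n))
            # concat (map (\<lambda>k. blk k (\<lambda>t. t / (1 - t\<^sup>2))) ms)) = tail_series n ms x"
proof -
  have "represents x (1 / (1 - (norm x)\<^sup>2)) (of_nat (Suc (2 * n))) [\<lambda>t. t ^ (2 * n)]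
      (odd_series (\<lambda>k. if k = n then 1 else 0))"
    using represents_power[OF x, of "2 * n"] unfolding odd_series_delta[abs_def] by simp
  from represents_iint[OF represents_blocks[OF x _ this ms]] show ?thesis
    by (simp add: tail_series_def)
qed

text \<open>The initial power integrates to \<open>z^(2n+2)\<close>, which is even, but
  \<open>1/(1-z^2) * z^(2n+2) = z/(1-z^2) * z^(2n+1)\<close>. So the first block leads to the same
  series as in \<open>iint_even_start\<close>.\<close>

lemma iint_odd_start:
  assumes x: "norm x < 1" and ms: "\<forall>m\<in>set (m # ms). 1 \<le> m"
  shows "of_nat (2 * n + 2) * iint 0 x ((\<lambda>t. t ^ (2 * n + 1)) # blk m (\<lambda>t. 1 / (1 - t\<^sup>2))
            @ concat (map (\<lambda>k. blk k (\<lambda>t. t / (1 - t\<^sup>2))) ms)) = tail_series n (m # ms) x"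
proof -
  have "represents x (1 / (1 - (norm x)\<^sup>2)) (of_nat (Suc (2 * n + 1)))
      ([\<lambda>t. t ^ (2 * n + 1)] @ blk m (\<lambda>t. 1 / (1 - t\<^sup>2)))
      (odd_series (blockstep (\<lambda>k. if k = n then 1 else 0) m))"
    by (rule represents_block[OF x _ represents_power[OF x]])
       (use ms in \<open>auto simp: odd_series_delta\<close>)
  moreover have "\<bar>blockstep (\<lambda>k. if k = n then 1 else 0) m k\<bar> \<le> 1" for k
    using ms by (intro blockstep_le) auto
  ultimately have "represents x (1 / (1 - (norm x)\<^sup>2)) (of_nat (Suc (2 * n + 1)))
      (([\<lambda>t. t ^ (2 * n + 1)] @ blk m (\<lambda>t. 1 / (1 - t\<^sup>2))) @
        concat (map (\<lambda>k. blk k (\<lambda>t. t / (1 - t\<^sup>2))) ms))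
      (odd_series (foldl blockstep (blockstep (\<lambda>k. if k = n then 1 else 0) m) ms))"
    using ms by (intro represents_blocks[OF x]) auto
  from represents_iint[OF this] show ?thesis by (simp add: tail_series_def)
qed

section \<open>Nested sums\<close>

text \<open>The first index \<open>l\<close> is the largest, and the remaining tuple is bounded by
  it; this yields the recursions for \<open>tstar\<close> and \<open>tstarx0\<close>.\<close>

lemma sum_idx_le_Suc:
  "(\<Sum>ns\<in>idx_le n (Suc r). F ns) = (\<Sum>l=1..n. \<Sum>ns\<in>idx_le l r. F (l # ns))"
proof -
  have fin: "finite (idx_le l r)" for l
    by (rule finite_subset[OF _ finite_lists_length_eq[of "{1..l}" r]])
       (auto simp: idx_le_def in_set_conv_nth)
  have set_le: "idx_le l q = {ns. length ns = q \<and> (\<forall>k\<in>set ns. 1 \<le> k \<and> k \<le> l) \<and> sorted_wrt (\<ge>) ns}" for l q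
    by (auto simp: idx_le_def all_set_conv_all_nth)
  have "idx_le n (Suc r) = (\<lambda>(l, ns). l # ns) ` (SIGMA l:{1..n}. idx_le l r)"
    unfolding set_le by (force simp: length_Suc_conv image_iff)
  moreover have "inj_on (\<lambda>(l, ns). l # ns) (SIGMA l:{1..n}. idx_le l r)"
    by (auto simp: inj_on_def)
  ultimately have "(\<Sum>ns\<in>idx_le n (Suc r). F ns) = (\<Sum>(l, ns)\<in>(SIGMA l:{1..n}. idx_le l r). F (l # ns))"
    by (simp add: sum.reindex case_prod_unfold)
  then show ?thesis by (simp add: sum.Sigma fin)
qed

lemma tstar_Nil [simp]: "tstar n [] = 1"
proof -
  have "idx_le n 0 = {[]}" by (auto simp: idx_le_def)
  then show ?thesis by (simp add: tstar_def)
qed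

lemma tstar_Cons: "tstar n (m # ms) = (\<Sum>l=1..n. 1 / of_nat (2 * l - 1) ^ m * tstar l ms)"
  by (simp add: tstar_def sum_idx_le_Suc prod.lessThan_Suc_shift sum_distrib_left del: prod.lessThan_Suc)

text \<open>For the empty composition \<^const>\<open>tstarx\<close> depends on the unspecified \<^term>\<open>last []\<close>;
  the value chosen here starts the recursion.\<close>
definition tstarx0 :: "nat \<Rightarrow> nat list \<Rightarrow> complex \<Rightarrow> complex" where
  "tstarx0 n ms x = (if ms = [] then x ^ (2 * n - 1) else tstarx n ms x)"

lemma tstarx0_Cons:
  "tstarx0 n (m # ms) x = (\<Sum>l=1..n. 1 / of_nat (2 * l - 1) ^ m * tstarx0 l ms x)"
proof (cases "ms = []")
  case True
  have "idx_le l 0 = {[]}" for l by (auto simp: idx_le_def)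
  with True show ?thesis
    by (simp add: tstarx0_def tstarx_def sum_idx_le_Suc)
next
  case False
  have "last (l # ns) = last ns" if "ns \<in> idx_le l (length ms)" for l ns
    using that False by (auto simp: idx_le_def)
  then have "tstarx n (m # ms) x = (\<Sum>l=1..n. \<Sum>ns\<in>idx_le l (length ms). x ^ (2 * last ns - 1) *
     (\<Prod>i<Suc (length ms). 1 / of_nat (2 * (l # ns) ! i - 1) ^ ((m # ms) ! i)))"
    by (simp add: tstarx_def sum_idx_le_Suc del: prod.lessThan_Suc last.simps)
  also have "\<dots> = (\<Sum>l=1..n. 1 / of_nat (2 * l - 1) ^ m * tstarx l ms x)"
    by (simp add: tstarx_def prod.lessThan_Suc_shift sum_distrib_left mult_ac del: prod.lessThan_Suc)
  finally show ?thesis using False by (simp add: tstarx0_def)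
qed

section \<open>Multiple t-polylogarithms as odd series\<close>

text \<open>These are the finite multiple t-sums over strictly decreasing indices at most
  \<open>k\<close>. The variable \<open>j\<close> stands for the index \<open>j + 1\<close>, so
  \<open>j < k\<close> means an index at most \<open>k\<close>.\<close>

fun nested :: "nat list \<Rightarrow> nat \<Rightarrow> real" where
  "nested [] k = 1"
| "nested (m # ms) k = (\<Sum>j<k. nested ms j / (2 * real j + 1) ^ m)"

definition idx_gt_le :: "nat \<Rightarrow> nat \<Rightarrow> nat list set" where
  "idx_gt_le r k = {ns \<in> idx_gt r. \<forall>n\<in>set ns. n \<le> k}"

lemma idx_gt_alt: "idx_gt r = {ns. length ns = r \<and> (\<forall>n\<in>set ns. 0 < n) \<and> sorted_wrt (>) ns}"
  by (auto simp: idx_gt_def all_set_conv_all_nth)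

lemma finite_idx_gt_le: "finite (idx_gt_le r k)"
  by (rule finite_subset[OF _ finite_lists_length_eq[of "{..k}" r]])
     (auto simp: idx_gt_le_def idx_gt_alt)

text \<open>Once the largest index is fixed only finitely many tuples remain, so \<open>ti\<close>
  becomes a series over \<open>j\<close> with finite inner sums.\<close>

lemma idx_gt_Suc: "idx_gt (Suc r) = (\<lambda>(j, ns). Suc j # ns) ` (SIGMA j:UNIV. idx_gt_le r j)"
proof (intro equalityI subsetI)
  fix ns assume "ns \<in> idx_gt (Suc r)"
  then obtain l ns' where "ns = l # ns'" "0 < l" "ns' \<in> idx_gt r" "\<forall>n\<in>set ns'. n < l"
    by (auto simp: idx_gt_alt length_Suc_conv)
  then show "ns \<in> (\<lambda>(j, ns). Suc j # ns) ` (SIGMA j:UNIV. idx_gt_le r j)"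
    by (intro image_eqI[of _ _ "(l - 1, ns')"]) (auto simp: idx_gt_le_def)
qed (auto simp: idx_gt_le_def idx_gt_alt less_Suc_eq_le)

lemma idx_gt_le_Suc: "idx_gt_le (Suc r) k = (\<lambda>(j, ns). Suc j # ns) ` (SIGMA j:{..<k}. idx_gt_le r j)"
proof -
  have "idx_gt_le (Suc r) k = {ns \<in> idx_gt (Suc r). hd ns \<le> k}"
    by (fastforce simp: idx_gt_le_def idx_gt_alt length_Suc_conv)
  then show ?thesis unfolding idx_gt_Suc by auto
qed

lemma inj_on_Suc_Cons: "inj_on (\<lambda>(j, ns). Suc j # ns) A"
  by (auto simp: inj_on_def)

lemma nested_eq_sum:
  "nested ms k = (\<Sum>ns\<in>idx_gt_le (length ms) k. \<Prod>i<length ms. 1 / real (2 * ns ! i - 1) ^ (ms ! i))"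
proof (induction ms arbitrary: k)
  case Nil
  have "idx_gt_le 0 k = {[]}" by (auto simp: idx_gt_le_def idx_gt_alt)
  then show ?case by simp
next
  case (Cons m ms)
  have "(\<Sum>ns\<in>idx_gt_le (Suc (length ms)) k. \<Prod>i<Suc (length ms). 1 / real (2 * ns ! i - 1) ^ ((m # ms) ! i))
    = (\<Sum>j<k. \<Sum>ns\<in>idx_gt_le (length ms) j. 1 / (2 * real j + 1) ^ m *
        (\<Prod>i<length ms. 1 / real (2 * ns ! i - 1) ^ (ms ! i)))"
    unfolding idx_gt_le_Suc sum.reindex[OF inj_on_Suc_Cons]
    by (simp add: case_prod_unfold sum.Sigma finite_idx_gt_le prod.lessThan_Suc_shift add_ac
        del: prod.lessThan_Suc)
  then show ?case
    by (simp add: Cons.IH sum_divide_distrib del: prod.lessThan_Suc)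
qed

lemma nested_nonneg: "0 \<le> nested ms k"
  by (induction ms arbitrary: k) (auto intro!: sum_nonneg)

text \<open>By induction every summand is at most 1, because its exponent is positive. Linear growth
  is enough, since the coefficients of \<open>ti\<close> carry a further division by
  \<open>2k + 1\<close>.\<close>

lemma nested_le:
  assumes "\<forall>m\<in>set ms. 1 \<le> m"
  shows "nested ms k \<le> 2 * real k + 1"
  using assms
proof (induction ms arbitrary: k)
  case (Cons m ms)
  have "nested ms j / (2 * real j + 1) ^ m \<le> 1" for j
  proof -
    have "nested ms j \<le> (2 * real j + 1) ^ 1" using Cons by simp
    also have "\<dots> \<le> (2 * real j + 1) ^ m" using Cons.prems by (intro power_increasing) auto
    finally show ?thesis by simp
  qed
  then have "nested (m # ms) k \<le> (\<Sum>j<k. 1)" unfolding nested.simps by (intro sum_mono)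
  then show ?case by simp
qed simp

lemma abs_nested_divide_le:
  assumes "\<forall>m\<in>set (m # ms). 1 \<le> m"
  shows "\<bar>nested ms k / (2 * real k + 1) ^ m\<bar> \<le> 1"
proof -
  have "nested ms k \<le> (2 * real k + 1) ^ 1" using nested_le[of ms] assms by simp
  also have "\<dots> \<le> (2 * real k + 1) ^ m" using assms by (intro power_increasing) auto
  finally show ?thesis using nested_nonneg[of ms k] by simp
qed

lemma ti_eq_odd_series:
  assumes ms: "\<forall>m\<in>set (m # ms). 1 \<le> m" and x: "norm x < 1"
  shows "ti (m # ms) x = odd_series (\<lambda>k. nested ms k / (2 * real k + 1) ^ m) x"
proof -
  let ?r = "length ms"
  let ?w = "\<lambda>ns. \<Prod>i<?r. 1 / real (2 * ns ! i - 1) ^ (ms ! i)"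
  let ?c = "\<lambda>k. nested ms k / (2 * real k + 1) ^ m"
  define f where "f j ns = complex_of_real (?w ns / (2 * real j + 1) ^ m) * x ^ (2 * j + 1)" for j ns
  have sum_f: "(\<Sum>ns\<in>idx_gt_le ?r j. f j ns) = of_real (?c j) * x ^ (2 * j + 1)" for j
    unfolding f_def nested_eq_sum by (simp add: sum_distrib_right sum_divide_distrib)
  have "norm (f j ns) = ?w ns / (2 * real j + 1) ^ m * norm x ^ (2 * j + 1)" for j ns
    unfolding f_def norm_mult norm_of_real norm_power
    by (subst abs_of_nonneg) (auto intro!: divide_nonneg_nonneg prod_nonneg)
  then have sum_norm_f: "(\<Sum>ns\<in>idx_gt_le ?r j. norm (f j ns)) = ?c j * norm x ^ (2 * j + 1)" for j
    unfolding nested_eq_sum by (simp add: sum_distrib_right sum_divide_distrib)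
  have summ: "summable (\<lambda>j. norm (of_real (?c j) * x ^ (2 * j + 1)))"
  proof (rule summable_comparison_test')
    show "summable (\<lambda>j. norm x ^ j)" using x by (intro summable_geometric) auto
    fix j
    have "\<bar>?c j\<bar> * norm x ^ (2 * j + 1) \<le> 1 * norm x ^ j"
      using x by (intro mult_mono abs_nested_divide_le[OF ms] power_decreasing) auto
    then show "norm (norm (of_real (?c j) * x ^ (2 * j + 1))) \<le> norm x ^ j"
      unfolding real_norm_def abs_norm_cancel norm_mult norm_power norm_of_real by simp
  qed
  \<comment> \<open>Absolute summability licenses summing fibre by fibre. The weights are
    nonnegative, so the norms in a fibre add up to the norm of one term of the series, which a
    geometric series dominates.\<close>
  have abs: "(\<lambda>p. norm (case p of (j, ns) \<Rightarrow> f j ns)) summable_on (SIGMA j:UNIV. idx_gt_le ?r j)"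
    unfolding Infinite_Sum.abs_summable_on_Sigma_iff
  proof (intro conjI ballI)
    show "(\<lambda>ns. norm (case (j, ns) of (j, ns) \<Rightarrow> f j ns)) summable_on idx_gt_le ?r j" for j
      by (simp add: finite_idx_gt_le)
    have "\<bar>?c j * norm x ^ (2 * j + 1)\<bar> = norm (of_real (?c j) * x ^ (2 * j + 1))" for j
      unfolding norm_mult norm_power norm_of_real abs_mult by simp
    then show "(\<lambda>j. norm (\<Sum>\<^sub>\<infinity>ns\<in>idx_gt_le ?r j. norm (case (j, ns) of (j, ns) \<Rightarrow> f j ns))) summable_on UNIV"
      using norm_summable_imp_summable_on[of "\<lambda>j. norm (of_real (?c j) * x ^ (2 * j + 1))"] summ
      by (simp add: finite_idx_gt_le sum_norm_f)
  qed
  have "ti (m # ms) x = (\<Sum>\<^sub>\<infinity>(j, ns)\<in>(SIGMA j:UNIV. idx_gt_le ?r j). f j ns)"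
    unfolding ti_def length_Cons idx_gt_Suc infsum_reindex[OF inj_on_Suc_Cons] o_def
    by (intro infsum_cong)
       (auto simp: f_def prod.lessThan_Suc_shift add_ac mult_ac simp del: prod.lessThan_Suc)
  also have "\<dots> = (\<Sum>\<^sub>\<infinity>j\<in>UNIV. \<Sum>\<^sub>\<infinity>ns\<in>idx_gt_le ?r j. f j ns)"
    by (rule infsum_Sigma'_banach[symmetric]) (rule abs_summable_summable[OF abs])
  also have "\<dots> = (\<Sum>\<^sub>\<infinity>j\<in>UNIV. of_real (?c j) * x ^ (2 * j + 1))"
    by (simp only: infsum_finite[OF finite_idx_gt_le] sum_f)
  also have "\<dots> = odd_series ?c x"
    unfolding odd_series_def
    by (intro infsumI norm_summable_imp_has_sum summ summable_sums summable_norm_cancel[OF summ])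
  finally show ?thesis .
qed

section \<open>Splitting off the first index and solving the recursion\<close>

text \<open>The start is the coefficient sequence of \<open>ti [m]\<close>, and each block puts its
  exponent in front, whence the reversed list. Head and tail are separated to match
  \<open>ti_eq_odd_series\<close>.\<close>

lemma foldl_blockstep_start:
  "foldl blockstep (\<lambda>k. 1 / (2 * real k + 1) ^ m) ms =
     (\<lambda>k. nested (tl (rev (m # ms))) k / (2 * real k + 1) ^ hd (rev (m # ms)))"
proof (induction ms rule: rev_induct)
  case (snoc m' ms)
  have "rev (m # ms) = hd (rev (m # ms)) # tl (rev (m # ms))" by simp
  then have "nested (rev (m # ms)) k =
      (\<Sum>j<k. nested (tl (rev (m # ms))) j / (2 * real j + 1) ^ hd (rev (m # ms)))" for k
    by (metis nested.simps(2))
  then show ?case by (simp add: snoc del: rev.simps) (simp add: blockstep_def fun_eq_iff)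
qed simp

text \<open>Linearity carries a splitting of the initial coefficients through all remaining
  blocks.\<close>

lemma foldl_blockstep_linear:
  "foldl blockstep (\<lambda>k. a k + (\<Sum>l\<in>I. w l * b l k)) ms =
     (\<lambda>k. foldl blockstep a ms k + (\<Sum>l\<in>I. w l * foldl blockstep (b l) ms k))"
proof (induction ms arbitrary: a b)
  case (Cons m ms)
  have "blockstep (\<lambda>k. a k + (\<Sum>l\<in>I. w l * b l k)) m k =
      blockstep a m k + (\<Sum>l\<in>I. w l * blockstep (b l) m k)" for k
    unfolding blockstep_def sum.distrib add_divide_distrib
    by (subst sum.swap) (simp add: sum_distrib_left sum_divide_distrib)
  then have "blockstep (\<lambda>k. a k + (\<Sum>l\<in>I. w l * b l k)) m =
      (\<lambda>k. blockstep a m k + (\<Sum>l\<in>I. w l * blockstep (b l) m k))" ..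
  then show ?case by (simp only: foldl_Cons Cons.IH)
qed simp

lemma foldl_blockstep_le:
  assumes "\<And>k. \<bar>c k\<bar> \<le> B" "\<forall>m\<in>set ms. 1 \<le> m"
  shows "\<bar>foldl blockstep c ms k\<bar> \<le> B"
  using assms
proof (induction ms arbitrary: c)
  case (Cons m ms)
  have "\<bar>foldl blockstep (blockstep c m) ms k\<bar> \<le> B"
    using Cons.prems by (intro Cons.IH blockstep_le) auto
  then show ?case by simp
qed simp

lemma ti_eq_tail_series:
  assumes ms: "\<forall>m\<in>set (m # ms). 1 \<le> m" and x: "norm x < 1"
  shows "ti (rev (m # ms)) x =
    tail_series n (m # ms) x + (\<Sum>l<Suc n. 1 / of_nat (2 * l + 1) ^ m * tail_series l ms x)"
proof -
  define d :: "nat \<Rightarrow> nat \<Rightarrow> real" where "d n = (\<lambda>k. if k = n then 1 else 0)" for n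
  define w where "w l = 1 / (2 * real l + 1) ^ m" for l
  \<comment> \<open>The full sum over the first index is cut at \<open>n\<close>: the partial sums
    of \<open>d n\<close> are 1 exactly for \<open>k > n\<close>, so \<open>blockstep\<close>
    supplies these \<open>k\<close>, and the weighted unit sequences supply
    \<open>k \<le> n\<close>.\<close>
  have "1 / (2 * real k + 1) ^ m = blockstep (d n) m k + (\<Sum>l<Suc n. w l * d l k)" for k
  proof -
    have "(\<Sum>l<Suc n. w l * d l k) = (\<Sum>l<Suc n. if l = k then w l else 0)"
      by (intro sum.cong) (auto simp: d_def)
    also have "\<dots> = (if k < Suc n then w k else 0)" by (subst sum.delta) auto
    finally have "(\<Sum>l<Suc n. w l * d l k) = (if k < Suc n then w k else 0)" .
    moreover have "(\<Sum>j<k. d n j) = (if n < k then 1 else 0)"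
      unfolding d_def by (subst sum.delta) auto
    ultimately show ?thesis by (auto simp: blockstep_def w_def)
  qed
  then have "(\<lambda>k. 1 / (2 * real k + 1) ^ m) = (\<lambda>k. blockstep (d n) m k + (\<Sum>l<Suc n. w l * d l k))"
    by blast
  then have fold: "foldl blockstep (\<lambda>k. 1 / (2 * real k + 1) ^ m) ms =
      (\<lambda>k. foldl blockstep (d n) (m # ms) k + (\<Sum>l<Suc n. w l * foldl blockstep (d l) ms k))"
    by (simp only: foldl_blockstep_linear foldl_Cons)
  have bd: "\<bar>d l k\<bar> \<le> 1" for l k by (simp add: d_def)
  have s1: "summable (\<lambda>k. of_real (foldl blockstep (d n) (m # ms) k) * x ^ (2 * k + 1))"
    by (rule odd_series_eq(2)[OF foldl_blockstep_le[OF bd ms] x])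
  have s2: "summable (\<lambda>k. of_real (foldl blockstep (d l) ms k) * x ^ (2 * k + 1))" for l
    using ms by (intro odd_series_eq(2)[OF foldl_blockstep_le[OF bd] x]) auto
  have "rev (m # ms) = hd (rev (m # ms)) # tl (rev (m # ms))" by simp
  moreover have "\<forall>k\<in>set (rev (m # ms)). 1 \<le> k" using ms by simp
  ultimately have "ti (rev (m # ms)) x = odd_series (foldl blockstep (\<lambda>k. 1 / (2 * real k + 1) ^ m) ms) x"
    unfolding foldl_blockstep_start using ti_eq_odd_series[OF _ x] by metis
  also have "\<dots> = (\<Sum>k. of_real (foldl blockstep (d n) (m # ms) k) * x ^ (2 * k + 1) +
      (\<Sum>l<Suc n. of_real (w l) * (of_real (foldl blockstep (d l) ms k) * x ^ (2 * k + 1))))"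
    unfolding fold odd_series_def
    by (simp only: of_real_add of_real_sum of_real_mult distrib_right sum_distrib_right mult.assoc)
  also have "\<dots> = odd_series (foldl blockstep (d n) (m # ms)) x +
      (\<Sum>l<Suc n. of_real (w l) * odd_series (foldl blockstep (d l) ms) x)"
    unfolding odd_series_def using s1 s2
    by (subst suminf_add[symmetric])
       (auto intro!: summable_sum summable_mult simp: suminf_sum suminf_mult simp del: sum.lessThan_Suc foldl_Cons)
  finally show ?thesis by (simp add: tail_series_def d_def[abs_def] w_def add_ac del: sum.lessThan_Suc foldl_Cons)
qed

text \<open>Solving \<open>ti_eq_tail_series\<close> for the tail series gives a recursion that
  calls the shorter list at every \<open>l \<le> n\<close>, hence the induction for arbitrary
  \<open>n\<close>. Each unfolding changes the sign and adds one summation to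
  \<open>tstar\<close>.\<close>

lemma tail_series_eq:
  assumes "\<forall>m\<in>set ms. 1 \<le> m" and x: "norm x < 1"
  shows "tail_series n ms x = (\<Sum>j<length ms. (-1) ^ j * tstar (Suc n) (take j ms) * ti (rev (drop j ms)) x)
     + (-1) ^ length ms * tstarx0 (Suc n) ms x"
  using assms(1)
proof (induction ms arbitrary: n)
  case Nil
  then show ?case by (simp add: tail_series_def odd_series_delta tstarx0_def)
next
  case (Cons m ms)
  define T where "T j = ti (rev (drop j ms)) x" for j
  define w where "w l = 1 / complex_of_nat (2 * l - 1) ^ m" for l
  have "(\<Sum>l<Suc n. 1 / of_nat (2 * l + 1) ^ m * tail_series l ms x) =
      (\<Sum>l<Suc n. w (Suc l) * ((\<Sum>j<length ms. (-1) ^ j * tstar (Suc l) (take j ms) * T j)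
         + (-1) ^ length ms * tstarx0 (Suc l) ms x))"
    using Cons by (intro sum.cong) (auto simp: T_def w_def)
  also have "\<dots> = (\<Sum>l=1..Suc n. w l * ((\<Sum>j<length ms. (-1) ^ j * tstar l (take j ms) * T j)
         + (-1) ^ length ms * tstarx0 l ms x))"
    by (rule sum.reindex_bij_witness[of _ "\<lambda>l. l - 1" Suc]) auto
  \<comment> \<open>The factors \<open>T j\<close> do not depend on \<open>l\<close>, so after
    exchanging the sums those over \<open>l\<close> are the recursions of \<open>tstar\<close> and
    \<open>tstarx0\<close>.\<close>
  also have "\<dots> = (\<Sum>j<length ms. (-1) ^ j * (\<Sum>l=1..Suc n. w l * tstar l (take j ms)) * T j)
         + (-1) ^ length ms * (\<Sum>l=1..Suc n. w l * tstarx0 l ms x)"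
    unfolding distrib_left sum.distrib sum_distrib_left sum_distrib_right
    by (subst sum.swap) (simp add: mult_ac del: sum.cl_ivl_Suc)
  also have "\<dots> = (\<Sum>j<length ms. (-1) ^ j * tstar (Suc n) (m # take j ms) * T j)
         + (-1) ^ length ms * tstarx0 (Suc n) (m # ms) x"
    unfolding tstar_Cons tstarx0_Cons w_def ..
  finally show ?case
    \<comment> \<open>The leading \<open>ti\<close> is the summand \<open>j = 0\<close> of the
      claim; the other summands move up by one index, with the sign reversed.\<close>
    using ti_eq_tail_series[OF Cons.prems x, of n]
    by (simp add: T_def sum.lessThan_Suc_shift sum_negf algebra_simps del: sum.lessThan_Suc)
qed

theorem mainTheorem7:
  fixes ms :: "nat list" and n :: nat and x :: complex
  assumes "ms \<noteq> []" and "\<forall>m\<in>set ms. 1 \<le> m" and "1 \<le> n" and "norm x < 1"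
  shows "of_nat (2 * n) * iint 0 x ((\<lambda>t. t ^ (2 * n - 1)) # blk (hd ms) (\<lambda>t. 1 / (1 - t\<^sup>2))
            @ concat (map (\<lambda>k. blk k (\<lambda>t. t / (1 - t\<^sup>2))) (tl ms)))
       = of_nat (2 * n - 1) * iint 0 x ((\<lambda>t. t ^ (2 * n - 2))
            # concat (map (\<lambda>k. blk k (\<lambda>t. t / (1 - t\<^sup>2))) ms))
   \<and> of_nat (2 * n - 1) * iint 0 x ((\<lambda>t. t ^ (2 * n - 2))
            # concat (map (\<lambda>k. blk k (\<lambda>t. t / (1 - t\<^sup>2))) ms))
       = (\<Sum>j=1..length ms. (-1) ^ (j - 1) * tstar n (take (j - 1) ms) * ti (rev (drop (j - 1) ms)) x)
         + (-1) ^ length ms * tstarx n ms x"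
proof -
  obtain n' where n: "n = Suc n'" using assms(3) by (cases n) auto
  have "of_nat (2 * n) * iint 0 x ((\<lambda>t. t ^ (2 * n - 1)) # blk (hd ms) (\<lambda>t. 1 / (1 - t\<^sup>2))
            @ concat (map (\<lambda>k. blk k (\<lambda>t. t / (1 - t\<^sup>2))) (tl ms))) = tail_series n' ms x"
    using iint_odd_start[OF assms(4), of "hd ms" "tl ms" n'] assms(1,2) by (simp add: n)
  moreover have "of_nat (2 * n - 1) * iint 0 x ((\<lambda>t. t ^ (2 * n - 2))
            # concat (map (\<lambda>k. blk k (\<lambda>t. t / (1 - t\<^sup>2))) ms)) = tail_series n' ms x"
    using iint_even_start[OF assms(4,2), of n'] by (simp add: n)
  moreover have "(\<Sum>j=1..length ms. (-1) ^ (j - 1) * tstar n (take (j - 1) ms) * ti (rev (drop (j - 1) ms)) x)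
      = (\<Sum>j<length ms. (-1) ^ j * tstar n (take j ms) * ti (rev (drop j ms)) x)"
    by (rule sum.reindex_bij_witness[of _ Suc "\<lambda>j. j - 1"]) auto
  \<comment> \<open>\<open>tail_series n'\<close> starts at coefficient index
    \<open>n' = n - 1\<close>, and for nonempty \<open>ms\<close> the value \<open>tstarx0\<close>
    is \<open>tstarx\<close>.\<close>
  ultimately show ?thesis
    using tail_series_eq[OF assms(2,4), of n'] assms(1) by (simp add: n tstarx0_def)
qed

end
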